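(* Let $v$ be a prime power and let $t\geq 2$ be an integer. (1) If $t$ is odd, then $$OCAN(t,v+2,t,v)\leq v^t \left(t- \frac{2}{1-v} \left(\frac{1}{v^{(t-1)/2}} -1\right) \right).$$ (2) If $t$ is even, then $$OCAN(t,v+2,t,v)\leq v^t \left(t-\frac{2}{1-v} \left(\frac{1}{v^{(t-2)/2}} -1\right) - \frac{1}{v^{t/2}} \right).$$
   Context: NRT poset: for positive integers $m,s$, the NRT poset $[m\cdot s]$ is the set $\{1,\ldots,ms\}$ partitioned into $m$ blocks $B_i=\{is+1,\ldots,(i+1)s\}$, $i=0,\ldots,m-1$, where each block is a chain $is+1\preceq is+2\preceq\cdots\preceq (i+1)s$ and elements of different blocks are incomparable. An ideal is a subset $I$ such that $b\in I$ and $a\preceq b$ imply $a\in I$; an anti-ideal is the complement of an ideal. Covering: given an $N\times n$ array over an alphabet $V$ of size $v$, a set of $t$ columns is covered if every $t$-tuple over $V$ occurs at least once as a row of the $N\times t$ subarray formed by those columns. Ordered covering array: for $2\le t\le ms$, an $OCA(N;t,m,s,v)$ is an $N\times ms$ array with entries from an alphabet of size $v$, with columns labeled by $[m\cdot s]$, such that for every anti-ideal $J$ of $[m\cdot s]$ with $|J|=t$ the set of columns labeled by $J$ is covered. $OCAN(t,m,s,v)$ is the smallest positive integer $N$ such that an $OCA(N;t,m,s,v)$ exists. *)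

theory Defs
  imports Complex_Main "HOL-Library.FuncSet" "HOL-Number_Theory.Prime_Powers"
begin

definition nrt_block :: "nat \<Rightarrow> nat \<Rightarrow> nat set" where
  "nrt_block s i = {i * s + 1..(i + 1) * s}"

definition nrt_carrier :: "nat \<Rightarrow> nat \<Rightarrow> nat set" where
  "nrt_carrier m s = {1..m * s}"

definition nrt_le :: "nat \<Rightarrow> nat \<Rightarrow> nat \<Rightarrow> nat \<Rightarrow> bool" where
  "nrt_le m s a b \<longleftrightarrow> (\<exists>i<m. a \<in> nrt_block s i \<and> b \<in> nrt_block s i \<and> a \<le> b)"

definition nrt_ideal :: "nat \<Rightarrow> nat \<Rightarrow> nat set \<Rightarrow> bool" where
  "nrt_ideal m s I \<longleftrightarrow>
     I \<subseteq> nrt_carrier m s \<and> (\<forall>a b. b \<in> I \<longrightarrow> nrt_le m s a b \<longrightarrow> a \<in> I)"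

definition nrt_anti_ideal :: "nat \<Rightarrow> nat \<Rightarrow> nat set \<Rightarrow> bool" where
  "nrt_anti_ideal m s J \<longleftrightarrow> (\<exists>I. nrt_ideal m s I \<and> J = nrt_carrier m s - I)"

(* An array is a function A from a row index r < N and a column label to the alphabet;
   a tuple over V indexed by the column set J is an element of J \<rightarrow>\<^sub>E V. *)
definition covered :: "nat \<Rightarrow> 'a set \<Rightarrow> (nat \<Rightarrow> nat \<Rightarrow> 'a) \<Rightarrow> nat set \<Rightarrow> bool" where
  "covered N V A J \<longleftrightarrow> (\<forall>x \<in> J \<rightarrow>\<^sub>E V. \<exists>r<N. \<forall>c\<in>J. A r c = x c)"

definition is_OCA ::
  "nat \<Rightarrow> nat \<Rightarrow> nat \<Rightarrow> nat \<Rightarrow> nat \<Rightarrow> 'a set \<Rightarrow> (nat \<Rightarrow> nat \<Rightarrow> 'a) \<Rightarrow> bool" where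
  "is_OCA N t m s v V A \<longleftrightarrow>
     0 < m \<and> 0 < s \<and> 2 \<le> t \<and> t \<le> m * s \<and>
     finite V \<and> card V = v \<and>
     (\<forall>r<N. \<forall>c\<in>nrt_carrier m s. A r c \<in> V) \<and>
     (\<forall>J. nrt_anti_ideal m s J \<and> card J = t \<longrightarrow> covered N V A J)"

(* Every finite alphabet can be relabelled by natural numbers, so drawing V from
   nat set is no restriction. *)
definition OCAN :: "nat \<Rightarrow> nat \<Rightarrow> nat \<Rightarrow> nat \<Rightarrow> nat" where
  "OCAN t m s v =
     (LEAST N. 0 < N \<and> (\<exists>(V :: nat set) A. is_OCA N t m s v V A))"

(* The minimum defining OCAN is attained: take all rows of length m * s. *)
lemma OCA_exists:
  assumes "0 < m" "0 < s" "2 \<le> t" "t \<le> m * s" "0 < v"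
  shows "\<exists>N>0. \<exists>(V :: nat set) A. is_OCA N t m s v V A"
proof -
  let ?C = "nrt_carrier m s" and ?V = "{..<v}"
  let ?F = "?C \<rightarrow>\<^sub>E ?V"
  have fin: "finite ?F"
    by (intro finite_PiE) (auto simp: nrt_carrier_def)
  have ne: "?F \<noteq> {}"
    using \<open>0 < v\<close> unfolding PiE_eq_empty_iff by blast
  obtain A where A: "bij_betw A {0..<card ?F} ?F"
    using ex_bij_betw_nat_finite[OF fin] by blast
  have "covered (card ?F) ?V A J" if J: "nrt_anti_ideal m s J" for J
    unfolding covered_def
  proof
    fix x assume x: "x \<in> J \<rightarrow>\<^sub>E ?V"
    define y where "y = restrict (\<lambda>c. if c \<in> J then x c else 0) ?C"
    have val: "(if c \<in> J then x c else 0) \<in> ?V" for c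
    proof (cases "c \<in> J")
      case True
      then show ?thesis using PiE_mem[OF x True] by simp
    next
      case False
      then show ?thesis using \<open>0 < v\<close> by simp
    qed
    have "y \<in> ?F"
      unfolding y_def restrict_PiE_iff using val by blast
    then have "y \<in> A ` {0..<card ?F}"
      by (simp only: bij_betw_imp_surj_on[OF A])
    then obtain r where r: "r < card ?F" "A r = y"
      unfolding image_iff Bex_def atLeastLessThan_iff by blast
    have "J \<subseteq> ?C"
      using J unfolding nrt_anti_ideal_def by blast
    then have "A r c = x c" if "c \<in> J" for c
      unfolding r(2) y_def using that by (simp add: subsetD)
    then show "\<exists>r<card ?F. \<forall>c\<in>J. A r c = x c"
      using r(1) by blast
  qed
  moreover have "A r c \<in> ?V" if "r < card ?F" "c \<in> ?C" for r c
  proof (rule PiE_mem[OF _ that(2)])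
    show "A r \<in> ?F"
      by (rule bij_betw_apply[OF A]) (simp only: atLeastLessThan_iff that(1) le0 simp_thms)
  qed
  ultimately have "is_OCA (card ?F) t m s v ?V A"
    unfolding is_OCA_def using assms by (intro conjI allI ballI impI finite_lessThan card_lessThan) blast+
  moreover have "0 < card ?F"
    using fin ne unfolding card_gt_0_iff by blast
  ultimately show ?thesis
    by blast
qed

end

(* Let F be the field with v elements, and let polynomials over F of degree less than u be written
   in base X - a for each a in F, in base a rootless quadratic q, and at infinity (leading
   coefficients). A polynomial is determined by u such entries provided that they form initial
   segments at the places and that an even number of them is taken at q: the difference of two
   polynomials with equal entries is divisible by a product of degree larger than its own. With u = t,
   the base-q digits as the entries of the last of the v + 2 blocks, and one row per polynomial,
   this gives an array C of v^t rows that covers all anti-ideals with an even number j of columns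
   in the last block, and also those with j = t.

   For each odd j < t, one adds v^t - v^j rows. Choose v^j rows of C that run through all tuples on
   the top j columns of the last block. For each of them, take an array of strength t - j on the
   first v + 1 blocks, relabel its columns so that its row of some fixed polynomial becomes the
   chosen row of C, and keep the last block constant. This covers the anti-ideals with parameter j,
   and v^j of the v^t rows lie in C already. The sum v^t + sum_{j < t odd} (v^t - v^j) equals the
   claimed bound for t = 2 and is at most the claimed bound for t > 2. *)

theory Submission
  imports "HOL-Algebra.Algebraic_Closure" "HOL-Number_Theory.Residues"
    "HOL-Combinatorics.Transposition" Defs
begin

section \<open>A covering array from a family of codes\<close>

lemma upper_subset_eq_interval:
  fixes S :: "nat set"
  assumes "S \<subseteq> {..n}" and up: "\<And>x y. x \<in> S \<Longrightarrow> x \<le> y \<Longrightarrow> y \<le> n \<Longrightarrow> y \<in> S"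
  shows "S = {Suc n - card S..n}"
proof (cases "S = {}")
  case False
  have fin: "finite S" using assms(1) finite_subset by blast
  have S: "S = {Min S..n}"
    using Min_in[OF fin False] Min_le[OF fin] assms(1) up[of "Min S"] by force
  then have "card S = Suc n - Min S" by (metis card_atLeastAtMost)
  moreover have "Min S \<le> n" using Min_in[OF fin False] assms(1) by auto
  ultimately have "Suc n - card S = Min S" by simp
  with S show ?thesis by simp
qed simp

text \<open>Labels start at 1, hence the shift. Label 0 lies in no block, but truncated subtraction
  would put it in block 0.\<close>

lemma mem_nrt_block_iff:
  assumes "0 < c" "0 < s"
  shows "c \<in> nrt_block s i \<longleftrightarrow> (c - 1) div s = i"
proof -
  have "(c - 1) div s = i \<longleftrightarrow> i * s \<le> c - 1 \<and> c - 1 < (i + 1) * s"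
    using assms(2) div_nat_eqI[of s i "c - 1"] dividend_less_times_div[of s "c - 1"]
    by (auto simp: mult.commute[of _ s])
  moreover have "i * s \<le> c - 1 \<longleftrightarrow> i * s + 1 \<le> c" using assms(1) by linarith
  moreover have "c - 1 < (i + 1) * s \<longleftrightarrow> c \<le> (i + 1) * s" using assms(1) by linarith
  ultimately show ?thesis unfolding nrt_block_def by (metis atLeastAtMost_iff)
qed

lemma nrt_block_subset_carrier: "i < m \<Longrightarrow> nrt_block s i \<subseteq> nrt_carrier m s"
  using mult_le_mono1[of "Suc i" m s] unfolding nrt_block_def nrt_carrier_def by auto

text \<open>\<open>h i\<close> is the number of columns of \<open>J\<close> in block \<open>i\<close>; the column \<open>(i + 1) * s - k\<close> is the
  \<open>k\<close>-th one from the top of its block.\<close>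

lemma nrt_anti_ideal_profile:
  assumes J: "nrt_anti_ideal m s J" and s: "0 < s"
  obtains h :: "nat \<Rightarrow> nat" where "sum h {..<m} = card J"
    and "\<And>i k. i < m \<Longrightarrow> k < h i \<Longrightarrow> (i + 1) * s - k \<in> J"
    and "\<And>c. c \<in> J \<Longrightarrow> (c - 1) div s < m \<and> c \<le> ((c - 1) div s + 1) * s
           \<and> ((c - 1) div s + 1) * s - c < h ((c - 1) div s)"
proof
  obtain I where I: "nrt_ideal m s I" and JI: "J = nrt_carrier m s - I"
    using J unfolding nrt_anti_ideal_def by blast
  have Jc: "J \<subseteq> nrt_carrier m s" using JI by blast
  have finJ: "finite J" using Jc unfolding nrt_carrier_def by (rule finite_subset) simp
  let ?h = "\<lambda>i. card (J \<inter> nrt_block s i)"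
  have blk: "(c - 1) div s < m \<and> c \<in> nrt_block s ((c - 1) div s)" if "c \<in> J" for c
  proof -
    have c: "0 < c" "c \<le> m * s" using that Jc unfolding nrt_carrier_def by auto
    then have "c - 1 < m * s" by simp
    then show ?thesis using less_mult_imp_div_less mem_nrt_block_iff[OF c(1) s] by simp
  qed
  have "(c - 1) div s = i" if "c \<in> nrt_block s i" for c i
    using that mem_nrt_block_iff[OF _ s, of c i] unfolding nrt_block_def by simp
  then have dis: "J \<inter> nrt_block s i \<inter> (J \<inter> nrt_block s i') = {}" if "i \<noteq> i'" for i i'
    using that by blast
  have "J = (\<Union>i<m. J \<inter> nrt_block s i)" using blk by blast
  then have "card J = card (\<Union>i<m. J \<inter> nrt_block s i)" by simp
  also have "\<dots> = sum ?h {..<m}" using finJ dis by (intro card_UN_disjoint) auto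
  finally show "sum ?h {..<m} = card J" ..
  \<comment> \<open>The complement of an ideal is closed upwards within each block, so its trace on
    a block is a top segment fixed by its cardinality.\<close>
  have int: "J \<inter> nrt_block s i = {Suc ((i + 1) * s) - ?h i..(i + 1) * s}" if i: "i < m" for i
  proof (rule upper_subset_eq_interval)
    fix x y assume x: "x \<in> J \<inter> nrt_block s i" and xy: "x \<le> y" "y \<le> (i + 1) * s"
    then have y: "y \<in> nrt_block s i" unfolding nrt_block_def by auto
    then have "nrt_le m s x y" using x xy i unfolding nrt_le_def by blast
    then have "y \<notin> I" using I x JI unfolding nrt_ideal_def by blast
    with y nrt_block_subset_carrier[OF i] JI show "y \<in> J \<inter> nrt_block s i" by blast
  qed (auto simp: nrt_block_def)
  show "(i + 1) * s - k \<in> J" if "i < m" "k < ?h i" for i k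
    using int[OF that(1)] that(2) by auto
  show "(c - 1) div s < m \<and> c \<le> ((c - 1) div s + 1) * s
          \<and> ((c - 1) div s + 1) * s - c < ?h ((c - 1) div s)" if c: "c \<in> J" for c
  proof -
    let ?i = "(c - 1) div s"
    have i: "?i < m" "c \<in> nrt_block s ?i" using blk[OF c] by auto
    then have "c \<in> {Suc ((?i + 1) * s) - ?h ?i..(?i + 1) * s}" using int[OF i(1)] c by blast
    then have "Suc ((?i + 1) * s) - ?h ?i \<le> c" "c \<le> (?i + 1) * s" by auto
    moreover have "?h ?i > 0" using i c finJ by (auto simp: card_gt_0_iff)
    ultimately show ?thesis using i(1) by linarith
  qed
qed

text \<open>\<open>P u\<close> indexes the rows of an array of strength \<open>u\<close>, and \<open>E u i k f\<close> is the entry of row \<open>f\<close>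
  in the \<open>k\<close>-th column from the top of block \<open>i\<close>. Block \<open>m\<close> is the exceptional one.\<close>

locale nrt_code =
  fixes v m :: nat and P :: "nat \<Rightarrow> 'p set" and E :: "nat \<Rightarrow> nat \<Rightarrow> nat \<Rightarrow> 'p \<Rightarrow> nat"
  assumes v_pos: "0 < v"
    and card_P: "\<And>u. card (P u) = v ^ u"
    and E_less: "\<And>u i k f. f \<in> P u \<Longrightarrow> E u i k f < v"
    and E_inj: "\<And>u h f g. \<lbrakk>sum h {..m} = u; even (h m) \<or> h m = u; f \<in> P u; g \<in> P u;
          \<And>i k. i \<le> m \<Longrightarrow> k < h i \<Longrightarrow> E u i k f = E u i k g\<rbrakk> \<Longrightarrow> f = g"
begin

lemma finite_P: "finite (P u)"
  using card_P[of u] v_pos by (metis card.infinite power_not_zero less_numeral_extra(3))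

text \<open>Counting: reading off the \<open>u\<close> prescribed entries is injective by
  \<open>E_inj\<close>, and there are \<open>v ^ u\<close> rows as well as \<open>v ^ u\<close>
  tuples, so every tuple occurs.\<close>

lemma E_surj:
  assumes "sum h {..m} = u" "even (h m) \<or> h m = u"
    and y: "\<And>i k. i \<le> m \<Longrightarrow> k < h i \<Longrightarrow> y i k < v"
  obtains f where "f \<in> P u" "\<And>i k. i \<le> m \<Longrightarrow> k < h i \<Longrightarrow> E u i k f = y i k"
proof -
  let ?D = "SIGMA i:{..m}. {..<h i}"
  let ?F = "\<lambda>f. restrict (\<lambda>(i, k). E u i k f) ?D"
  let ?T = "?D \<rightarrow>\<^sub>E {..<v}"
  have inj: "inj_on ?F (P u)"
  proof (rule inj_onI, rule E_inj[OF assms(1,2)])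
    fix f g i k assume eq: "?F f = ?F g" and ik: "i \<le> m" "k < h i"
    show "E u i k f = E u i k g" using fun_cong[OF eq, of "(i, k)"] ik by simp
  qed auto
  have "?F ` P u \<subseteq> ?T"
  proof (rule image_subsetI)
    fix f assume "f \<in> P u"
    then show "?F f \<in> ?T" unfolding restrict_PiE_iff using E_less by auto
  qed
  moreover have "card (?F ` P u) = card ?T"
    using card_image[OF inj] by (simp add: card_P card_PiE assms(1))
  moreover have "finite ?T" by (intro finite_PiE) auto
  ultimately have "?F ` P u = ?T" by (metis card_subset_eq)
  moreover have "restrict (\<lambda>(i, k). y i k) ?D \<in> ?T" unfolding restrict_PiE_iff using y by auto
  ultimately obtain f where f: "f \<in> P u" "restrict (\<lambda>(i, k). y i k) ?D = ?F f" by blast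
  have "E u i k f = y i k" if "i \<le> m" "k < h i" for i k
    using fun_cong[OF f(2), of "(i, k)"] that by simp
  with f(1) that show thesis by blast
qed

text \<open>Supplies the rows to which the additional rows for parameter \<open>j\<close> are
  fitted. The profile with all \<open>t\<close> entries in block \<open>m\<close> is admissible
  whatever the parity of \<open>t\<close>, so each \<open>j\<close>-tuple, padded with zeros, is
  realised by a row; one such row per tuple is kept.\<close>

lemma section_exists:
  assumes "j \<le> t"
  shows "\<exists>S\<subseteq>P t. card S \<le> v ^ j \<and> (\<forall>y. (\<forall>k<j. y k < v) \<longrightarrow> (\<exists>f\<in>S. \<forall>k<j. E t m k f = y k))"
proof -
  let ?T = "{..<j} \<rightarrow>\<^sub>E {..<v}"
  have "\<exists>f\<in>P t. \<forall>k<j. E t m k f = y k" if y: "\<And>k. k < j \<Longrightarrow> y k < v" for y :: "nat \<Rightarrow> nat"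
  proof -
    obtain f where "f \<in> P t"
      and f: "\<And>i k. i \<le> m \<Longrightarrow> k < (if i = m then t else 0) \<Longrightarrow> E t i k f = (if k < j then y k else 0)"
      by (rule E_surj[where h = "\<lambda>i. if i = m then t else 0" and u = t
            and y = "\<lambda>i k. if k < j then y k else 0"])
        (use y v_pos in auto)
    then show ?thesis using f[of m] assms by (auto intro!: bexI[of _ f])
  qed
  then have "\<forall>y\<in>?T. \<exists>f\<in>P t. \<forall>k<j. E t m k f = y k" by (simp add: PiE_iff)
  then obtain F where F: "\<And>y. y \<in> ?T \<Longrightarrow> F y \<in> P t \<and> (\<forall>k<j. E t m k (F y) = y k)" by metis
  show ?thesis
  proof (intro exI[of _ "F ` ?T"] conjI allI impI)
    show "F ` ?T \<subseteq> P t" using F by blast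
    have "finite ?T" by (intro finite_PiE) auto
    then have "card (F ` ?T) \<le> card ?T" by (rule card_image_le)
    then show "card (F ` ?T) \<le> v ^ j" by (simp add: card_PiE)
    fix y :: "nat \<Rightarrow> nat" assume y: "\<forall>k<j. y k < v"
    then have "restrict y {..<j} \<in> ?T" by auto
    with F[OF this] show "\<exists>f\<in>F ` ?T. \<forall>k<j. E t m k f = y k"
      by (intro bexI[of _ "F (restrict y {..<j})"]) auto
  qed
qed

text \<open>The summand for \<open>j\<close> bounds the number of pairs of a row of strength
  \<open>t - j\<close>, other than a fixed reference row, and a row selected by
  \<open>section_exists\<close>.\<close>

theorem OCAN_le:
  assumes t: "2 \<le> t"
  shows "OCAN t (m + 1) t v \<le> v ^ t + (\<Sum>j | odd j \<and> j < t. (v ^ (t - j) - 1) * v ^ j)"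
proof -
  \<comment> \<open>\<open>?i c\<close> is the block of the label \<open>c\<close>, and
    \<open>?k c\<close> is its distance from the top of that block.\<close>
  let ?i = "\<lambda>c. (c - 1) div t" and ?k = "\<lambda>c. ((c - 1) div t + 1) * t - c"
  define good where "good j S \<longleftrightarrow> S \<subseteq> P t \<and> card S \<le> v ^ j \<and>
      (\<forall>y. (\<forall>k<j. y k < v) \<longrightarrow> (\<exists>f\<in>S. \<forall>k<j. E t m k f = y k))" for j S
  have "\<exists>S. good j S" if "j \<le> t" for j
    unfolding good_def by (rule section_exists[OF that])
  then have "\<forall>j. \<exists>S. j \<le> t \<longrightarrow> good j S" by blast
  from choice[OF this] obtain S where S0: "\<And>j. j \<le> t \<Longrightarrow> good j (S j)" by blast
  have S1: "S j \<subseteq> P t" and S2: "card (S j) \<le> v ^ j" if "j \<le> t" for j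
    using S0[OF that] unfolding good_def by blast+
  have S3: "\<exists>f\<in>S j. \<forall>k<j. E t m k f = y k" if "j \<le> t" "\<And>k. k < j \<Longrightarrow> y k < v" for j y
    using S0[OF that(1)] that(2) unfolding good_def by blast
  have "P u \<noteq> {}" for u
    using card_P[of u] v_pos by (metis card.empty power_not_zero less_numeral_extra(3))
  then have "\<forall>u. \<exists>f. f \<in> P u" by blast
  from choice[OF this] obtain z where z: "\<And>u. z u \<in> P u" by blast
  define row0 where "row0 f c = E t (?i c) (?k c) f" for f c
  \<comment> \<open>In each column outside block \<open>m\<close>, the alphabet is permuted by
    swapping the entries of the reference row \<open>z (t - j)\<close> and of \<open>f\<close>. This
    keeps the strength of the array and turns the reference row into \<open>f\<close>; block
    \<open>m\<close> does not depend on \<open>g\<close>.\<close>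
  define row where "row j g f c = (if ?i c = m then E t m (?k c) f
      else transpose (E (t - j) (?i c) (?k c) (z (t - j))) (E t (?i c) (?k c) f)
             (E (t - j) (?i c) (?k c) g))" for j g f c
  define Q where "Q = {j. odd j \<and> j < t}"
  \<comment> \<open>Pairs with \<open>g = z (t - j)\<close> are left out, since they give
    \<open>row0 f\<close> again.\<close>
  define D where "D j = (P (t - j) - {z (t - j)}) \<times> S j" for j
  define W where "W = row0 ` P t \<union> (\<Union>j\<in>Q. (\<lambda>(g, f). row j g f) ` D j)"
  have finQ: "finite Q" unfolding Q_def by simp
  have finD: "finite (D j)" if "j \<in> Q" for j
    using that finite_subset[OF S1 finite_P, of j] finite_P unfolding D_def Q_def by simp
  have finW: "finite W" unfolding W_def using finite_P finQ finD by blast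
  have row_z: "row j (z (t - j)) f = row0 f" for j f
    unfolding row_def row0_def by (auto intro!: ext)
  have row_in: "row j g f \<in> W" if "j \<in> Q" "g \<in> P (t - j)" "f \<in> S j" for j g f
  proof (cases "g = z (t - j)")
    case True
    then show ?thesis using that S1[of j] row_z unfolding W_def Q_def by auto
  next
    case False
    then have "(g, f) \<in> D j" using that unfolding D_def by blast
    then have "row j g f \<in> (\<lambda>(g, f). row j g f) ` D j" by (rule rev_image_eqI) simp
    then show ?thesis using that(1) unfolding W_def by blast
  qed
  have row_less: "row j g f c < v" if "g \<in> P (t - j)" "f \<in> P t" for j g f c
    using E_less[OF that(1)] E_less[OF that(2)] E_less[OF z]
    unfolding row_def by (simp add: transpose_def)
  have W_less: "w c < v" if "w \<in> W" for w c
  proof -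
    consider f where "f \<in> P t" "w = row0 f"
      | j g f where "j \<in> Q" "g \<in> P (t - j)" "f \<in> S j" "w = row j g f"
      using \<open>w \<in> W\<close> unfolding W_def D_def by auto
    then show ?thesis
    proof cases
      case 1
      then show ?thesis using E_less unfolding row0_def by simp
    next
      case 2
      then show ?thesis using S1[of j] row_less unfolding Q_def by auto
    qed
  qed
  have "card W \<le> card (row0 ` P t) + card (\<Union>j\<in>Q. (\<lambda>(g, f). row j g f) ` D j)"
    unfolding W_def by (rule card_Un_le)
  also have "card (row0 ` P t) \<le> v ^ t"
    using card_image_le[OF finite_P, of row0 t] card_P by simp
  also have "card (\<Union>j\<in>Q. (\<lambda>(g, f). row j g f) ` D j) \<le> (\<Sum>j\<in>Q. card ((\<lambda>(g, f). row j g f) ` D j))"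
    by (rule card_UN_le[OF finQ])
  also have "\<dots> \<le> (\<Sum>j\<in>Q. (v ^ (t - j) - 1) * v ^ j)"
  proof (rule sum_mono)
    fix j assume j: "j \<in> Q"
    have "card ((\<lambda>(g, f). row j g f) ` D j) \<le> card (D j)" using finD[OF j] by (rule card_image_le)
    also have "\<dots> = (v ^ (t - j) - 1) * card (S j)"
      unfolding D_def using z finite_P card_P by (simp add: card_cartesian_product)
    also have "\<dots> \<le> (v ^ (t - j) - 1) * v ^ j" using S2[of j] j unfolding Q_def by simp
    finally show "card ((\<lambda>(g, f). row j g f) ` D j) \<le> (v ^ (t - j) - 1) * v ^ j" .
  qed
  finally have card_W: "card W \<le> v ^ t + (\<Sum>j\<in>Q. (v ^ (t - j) - 1) * v ^ j)" by simp
  obtain A where A: "bij_betw A {0..<card W} W"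
    using ex_bij_betw_nat_finite[OF finW] by blast
  have "\<exists>w\<in>W. \<forall>c\<in>J. w c = x c"
    if J: "nrt_anti_ideal (m + 1) t J" "card J = t" and x: "x \<in> J \<rightarrow>\<^sub>E {..<v}" for J x
  proof -
    have "0 < t" using t by simp
    obtain h where
      hsum: "sum h {..<m + 1} = card J"
      and hJ: "\<And>i k. i < m + 1 \<Longrightarrow> k < h i \<Longrightarrow> (i + 1) * t - k \<in> J"
      and Jh: "\<And>c. c \<in> J \<Longrightarrow> ?i c < m + 1 \<and> c \<le> (?i c + 1) * t \<and> ?k c < h (?i c)"
      by (rule nrt_anti_ideal_profile[OF J(1) \<open>0 < t\<close>], rule that)
    have hsum: "sum h {..m} = t" using hsum J(2) by (simp add: lessThan_Suc_atMost)
    define y where "y i k = x ((i + 1) * t - k)" for i k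
    have y: "y i k < v" if "i \<le> m" "k < h i" for i k
      using PiE_mem[OF x hJ[of i k]] that unfolding y_def by simp
    have xy: "x c = y (?i c) (?k c) \<and> ?i c \<le> m \<and> ?k c < h (?i c)" if "c \<in> J" for c
      using Jh[OF that] unfolding y_def by simp
    show ?thesis
    proof (cases "even (h m) \<or> h m = t")
      case True
      obtain f where f: "f \<in> P t" "\<And>i k. i \<le> m \<Longrightarrow> k < h i \<Longrightarrow> E t i k f = y i k"
        by (rule E_surj[OF hsum True, of y], rule y, assumption+, rule that)
      have "row0 f c = x c" if "c \<in> J" for c
        using f(2)[of "?i c" "?k c"] xy[OF that] unfolding row0_def by simp
      moreover have "row0 f \<in> W" using f(1) unfolding W_def by blast
      ultimately show ?thesis by blast
    next
      case False
      let ?j = "h m"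
      have "sum h {..m} = sum h {..<m} + h m" by (simp flip: lessThan_Suc_atMost)
      then have hm: "sum h {..<m} = t - ?j" "?j \<le> t" using hsum by auto
      then have j: "?j \<in> Q" using False unfolding Q_def by simp
      obtain f where f: "f \<in> S ?j" "\<And>k. k < ?j \<Longrightarrow> E t m k f = y m k"
        using S3[OF hm(2), of "y m"] y[OF le_refl] by auto
      have fP: "f \<in> P t" using f(1) S1[OF hm(2)] by blast
      \<comment> \<open>A transposition is its own inverse: if \<open>g\<close> has the entry
        \<open>?s i k a\<close>, the relabelled row shows \<open>a\<close>.\<close>
      let ?s = "\<lambda>i k. transpose (E (t - ?j) i k (z (t - ?j))) (E t i k f)"
      have s: "?s i k a < v" if "a < v" for i k a
        using that E_less[OF fP] E_less[OF z] by (auto simp: transpose_def)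
      \<comment> \<open>Emptying block \<open>m\<close> leaves a profile of size
        \<open>t - h m\<close> with 0, an even number, in the last block, so it is admissible for
        strength \<open>t - h m\<close>.\<close>
      obtain g where g: "g \<in> P (t - ?j)"
        "\<And>i k. i \<le> m \<Longrightarrow> k < (h(m := 0)) i \<Longrightarrow> E (t - ?j) i k g = ?s i k (y i k)"
      proof (rule E_surj[of "h(m := 0)" "t - ?j" "\<lambda>i k. ?s i k (y i k)"])
        have "sum (h(m := 0)) {..m} = sum (h(m := 0)) {..<m}" by (simp flip: lessThan_Suc_atMost)
        also have "\<dots> = sum h {..<m}" by (intro sum.cong) auto
        finally show "sum (h(m := 0)) {..m} = t - ?j" using hm(1) by simp
      qed (use s y in \<open>auto split: if_splits\<close>)
      have "row ?j g f c = x c" if c: "c \<in> J" for c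
        using xy[OF c] g(2)[of "?i c" "?k c"] f(2)[of "?k c"] unfolding row_def by (auto simp: Let_def)
      then show ?thesis using row_in[OF j g(1) f(1)] by blast
    qed
  qed
  moreover have "\<exists>r<card W. A r = w" if "w \<in> W" for w
  proof -
    have "w \<in> A ` {0..<card W}" unfolding bij_betw_imp_surj_on[OF A] by (rule that)
    then show ?thesis by auto
  qed
  ultimately have "covered (card W) {..<v} A J" if "nrt_anti_ideal (m + 1) t J" "card J = t" for J
    unfolding covered_def using that by metis
  moreover have "A r c < v" if "r < card W" for r c
    using W_less bij_betwE[OF A] that by simp
  ultimately have "is_OCA (card W) t (m + 1) t v {..<v} A"
    unfolding is_OCA_def using t by auto
  moreover have "0 < card W"
    using finW z[of t] unfolding W_def by (auto simp: card_gt_0_iff)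
  ultimately have "0 < card W \<and> (\<exists>(V :: nat set) A. is_OCA (card W) t (m + 1) t v V A)"
    by blast
  then have "OCAN t (m + 1) t v \<le> card W"
    unfolding OCAN_def by (rule Least_le)
  with card_W show ?thesis unfolding Q_def by simp
qed

end

section \<open>Existence of finite fields\<close>

lemma (in cring) binomial:
  assumes a: "a \<in> carrier R" and b: "b \<in> carrier R"
  shows "(a \<oplus> b) [^] (n::nat) = (\<Oplus>k\<in>{..n}. [(n choose k)] \<cdot> (a [^] k \<otimes> b [^] (n - k)))"
proof (induction n)
  case 0
  show ?case using a b by (simp)
next
  case (Suc n)
  let ?f = "\<lambda>k. [(n choose k)] \<cdot> (a [^] k \<otimes> b [^] (n - k))"
  let ?g = "\<lambda>k. [(n choose k)] \<cdot> (a [^] Suc k \<otimes> b [^] (n - k))"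
  let ?h = "\<lambda>k. [(n choose k)] \<cdot> (a [^] k \<otimes> b [^] (Suc n - k))"
  have "(a \<oplus> b) [^] Suc n = (\<Oplus>k\<in>{..n}. ?f k) \<otimes> a \<oplus> (\<Oplus>k\<in>{..n}. ?f k) \<otimes> b"
    using a b by (simp add: Suc r_distr)
  also have "(\<Oplus>k\<in>{..n}. ?f k) \<otimes> a = (\<Oplus>k\<in>{..n}. ?f k \<otimes> a)"
    using a b by (intro finsum_ldistr) auto
  also have "\<dots> = (\<Oplus>k\<in>{..n}. ?g k)"
    using a b by (intro finsum_cong') (auto simp: add_pow_ldistr add_pow_rdistr m_ac)
  also have "(\<Oplus>k\<in>{..n}. ?f k) \<otimes> b = (\<Oplus>k\<in>{..n}. ?f k \<otimes> b)"
    using a b by (intro finsum_ldistr) auto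
  also have "\<dots> = (\<Oplus>k\<in>{..n}. ?h k)"
    using a b by (intro finsum_cong') (auto simp: add_pow_ldistr add_pow_rdistr m_ac Suc_diff_le)
  \<comment> \<open>The term added for \<open>k = Suc n\<close> has binomial coefficient zero.
    Splitting off \<open>k = 0\<close> instead aligns \<open>?h (Suc k)\<close> with
    \<open>?g k\<close> for Pascal's rule.\<close>
  also have "\<dots> = (\<Oplus>k\<in>{..Suc n}. ?h k)"
    using a b by (simp add: binomial_eq_0)
  also have "\<dots> = (\<Oplus>k\<in>{..n}. ?h (Suc k)) \<oplus> b [^] Suc n"
    using a b by (subst add.finprod_Suc2) (auto simp: add.nat_pow_Suc)
  also have "(\<Oplus>k\<in>{..n}. ?g k) \<oplus> ((\<Oplus>k\<in>{..n}. ?h (Suc k)) \<oplus> b [^] Suc n) =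
      (\<Oplus>k\<in>{..n}. ?g k \<oplus> ?h (Suc k)) \<oplus> b [^] Suc n"
    using a b by (subst add.finprod_multf) (auto simp: a_assoc)
  also have "(\<Oplus>k\<in>{..n}. ?g k \<oplus> ?h (Suc k)) =
      (\<Oplus>k\<in>{..n}. [(Suc n choose Suc k)] \<cdot> (a [^] Suc k \<otimes> b [^] (Suc n - Suc k)))"
    using a b by (intro finsum_cong') (auto simp: add.nat_pow_mult)
  also have "\<dots> \<oplus> b [^] Suc n = (\<Oplus>k\<in>{..Suc n}. [(Suc n choose k)] \<cdot> (a [^] k \<otimes> b [^] (Suc n - k)))"
    using a b by (subst add.finprod_Suc2) (auto simp: add.nat_pow_Suc)
  finally show ?case .
qed

lemma (in cring) add_pow_char_dvd:
  assumes "[p] \<cdot> \<one> = \<zero>" "p dvd (n :: nat)" "x \<in> carrier R"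
  shows "[n] \<cdot> x = \<zero>"
proof -
  obtain q where n: "n = p * q" using assms(2) by blast
  have "[p] \<cdot> x = ([p] \<cdot> \<one>) \<otimes> x" using assms(3) by (simp add: add_pow_ldistr)
  then have "[p] \<cdot> x = \<zero>" using assms by simp
  then have "[q] \<cdot> ([p] \<cdot> x) = \<zero>" by simp
  then show ?thesis using assms(3) unfolding n by (simp add: add.nat_pow_pow mult.commute)
qed

text \<open>For \<open>0 < k < p\<close> the prime \<open>p\<close> divides
  \<open>p choose k\<close>, so only the outer terms of the binomial expansion survive; iteration
  gives the powers of \<open>p\<close>.\<close>

lemma (in cring) frobenius_add:
  assumes p: "prime (p :: nat)" "[p] \<cdot> \<one> = \<zero>" and ab: "a \<in> carrier R" "b \<in> carrier R"
  shows "(a \<oplus> b) [^] (p ^ n) = a [^] (p ^ n) \<oplus> b [^] (p ^ n)"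
proof (induction n)
  case 0
  show ?case using ab by (simp add: nat_pow_eone)
next
  case (Suc n)
  have step: "(x \<oplus> y) [^] p = x [^] p \<oplus> y [^] p" if xy: "x \<in> carrier R" "y \<in> carrier R" for x y
  proof -
    let ?f = "\<lambda>k. [(p choose k)] \<cdot> (x [^] k \<otimes> y [^] (p - k))"
    have "p > 0" using p(1) prime_gt_0_nat by blast
    have "(x \<oplus> y) [^] p = (\<Oplus>k\<in>{..p}. ?f k)" by (rule binomial[OF xy])
    also have "\<dots> = (\<Oplus>k\<in>{0, p}. ?f k)"
    proof (rule add.finprod_mono_neutral_cong_right)
      fix k assume "k \<in> {..p} - {0, p}"
      then have k: "0 < k" "k < p" by auto
      \<comment> \<open>Here \<open>k * (p choose k) = p * (p - 1 choose (k - 1))\<close>; the prime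
        \<open>p\<close> does not divide \<open>k < p\<close>.\<close>
      then have "p dvd k * (p choose k)" by (simp add: times_binomial_minus1_eq)
      then have "p dvd (p choose k)"
        using k p(1) prime_dvd_mult_nat nat_dvd_not_less by blast
      then show "?f k = \<zero>" using xy by (intro add_pow_char_dvd[OF p(2)]) auto
    qed (use xy in auto)
    also have "\<dots> = x [^] p \<oplus> y [^] p"
      using xy \<open>p > 0\<close> by (simp add: add.m_comm)
    finally show ?thesis .
  qed
  have "(a \<oplus> b) [^] (p ^ Suc n) = ((a \<oplus> b) [^] (p ^ n)) [^] p"
    using ab by (simp add: nat_pow_pow mult.commute)
  also have "\<dots> = (a [^] (p ^ n)) [^] p \<oplus> (b [^] (p ^ n)) [^] p"
    using ab by (simp add: Suc step)
  also have "\<dots> = a [^] (p ^ Suc n) \<oplus> b [^] (p ^ Suc n)"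
    using ab by (simp add: nat_pow_pow mult.commute)
  finally show ?case .
qed

text \<open>Carries \<open>[p] \<cdot> \<one> = \<zero>\<close> from the prime field to its
  algebraic closure, and from there to the polynomial ring.\<close>

lemma ring_hom_add_pow_one:
  assumes "ring R" "ring S" "h \<in> ring_hom R S"
  shows "h ([(n :: nat)] \<cdot>\<^bsub>R\<^esub> \<one>\<^bsub>R\<^esub>) = [n] \<cdot>\<^bsub>S\<^esub> \<one>\<^bsub>S\<^esub>"
proof -
  interpret R: ring R by fact
  interpret S: ring S by fact
  show ?thesis
    by (induction n) (simp_all add: ring_hom_zero[OF assms(3,1,2)] ring_hom_add[OF assms(3)]
        ring_hom_one[OF assms(3)] R.add.nat_pow_Suc S.add.nat_pow_Suc)
qed

section \<open>The roots of \<open>X ^ p ^ n - X\<close> and the field they form\<close>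

lemma (in field) linear_poly_closed:
  assumes "a \<in> carrier R"
  shows "[\<one>, \<ominus> a] \<in> carrier (poly_ring R)"
  using assms by (simp flip: univ_poly_carrier add: polynomial_def)

lemma (in field) var_eq_linear_plus_const:
  assumes "a \<in> carrier R"
  shows "X = [\<one>, \<ominus> a] \<oplus>\<^bsub>poly_ring R\<^esub> poly_of_const a"
  using assms unfolding univ_poly_add poly_of_const_def var_def by (auto simp: l_neg)

text \<open>In characteristic \<open>p\<close>, \<open>X ^ p ^ n - X = (X - a) ^ p ^ n - (X - a)\<close> for every root \<open>a\<close>
  of \<open>X ^ p ^ n - X\<close>, so that all roots are simple.\<close>

lemma (in algebraically_closed) card_frobenius_fixed:
  assumes p: "prime (p :: nat)" "[p] \<cdot> \<one> = \<zero>" and n: "n > 0"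
  shows "card {x \<in> carrier L. x [^] (p ^ n) = x} = p ^ n" (is "card ?S = ?v")
proof -
  let ?P = "poly_ring L"
  interpret P: domain ?P by (rule univ_poly_is_domain[OF carrier_is_subring])
  have hom: "poly_of_const \<in> ring_hom L ?P"
    using canonical_embedding_is_hom[OF carrier_is_subring] by simp
  have "[p] \<cdot>\<^bsub>?P\<^esub> \<one>\<^bsub>?P\<^esub> = poly_of_const ([p] \<cdot> \<one>)"
    by (rule ring_hom_add_pow_one[symmetric, OF ring_axioms P.ring_axioms hom])
  then have char: "[p] \<cdot>\<^bsub>?P\<^esub> \<one>\<^bsub>?P\<^esub> = \<zero>\<^bsub>?P\<^esub>"
    using ring_hom_zero[OF hom ring_axioms P.ring_axioms] p(2) by simp
  have v: "?v > 1" using n p(1) prime_gt_1_nat one_less_power by blast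
  let ?f = "X [^]\<^bsub>?P\<^esub> ?v \<ominus>\<^bsub>?P\<^esub> X"
  have X: "X \<in> carrier ?P" "polynomial (carrier L) X" by (rule var_closed[OF carrier_is_subring])+
  have f: "?f \<in> carrier ?P" using X(1) by simp
  have degX: "degree (X [^]\<^bsub>?P\<^esub> ?v) = ?v"
    using polynomial_pow_degree[OF X(1), of ?v] by (simp add: var_def)
  have degnX: "degree (\<ominus>\<^bsub>?P\<^esub> X) = 1"
    using univ_poly_a_inv_degree[OF carrier_is_subring X(1)] by (simp add: var_def)
  have "degree ?f = max ?v 1"
    unfolding a_minus_def univ_poly_add using X(1) v n degX degnX
    by (subst poly_add_degree_eq[OF carrier_is_subring]) (auto simp: univ_poly_carrier)
  then have deg: "degree ?f = ?v" using v by simp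
  then have nz: "?f \<noteq> []" using v by (metis diff_0_eq_0 less_nat_zero_code list.size(3))
  have eval: "eval ?f x = x [^] ?v \<ominus> x" if x: "x \<in> carrier L" for x
  proof -
    interpret ev: ring_hom_cring ?P L "\<lambda>q. eval q x"
      by (rule eval_cring_hom[OF carrier_is_subring x])
    show ?thesis using X(1) x by (simp add: a_minus_def eval_var)
  qed
  have "eval ?f x = \<zero> \<longleftrightarrow> x [^] ?v = x" if "x \<in> carrier L" for x
    unfolding eval[OF that] using that by (intro r_right_minus_eq) auto
  then have root_iff: "is_root ?f x \<longleftrightarrow> x \<in> ?S" for x
    using nz by (auto simp: is_root_def)
  have simple: "count (roots ?f) a = 1" if a: "a \<in># roots ?f" for a
  proof (rule ccontr)
    let ?Y = "[\<one>, \<ominus> a]" and ?C = "poly_of_const a"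
    assume "count (roots ?f) a \<noteq> 1"
    moreover have "count (roots ?f) a \<noteq> 0" using a by (simp only: count_eq_zero_iff not_not)
    ultimately have two: "2 \<le> alg_mult ?f a" unfolding alg_mult_eq_count_roots[OF f] by linarith
    have aS: "a \<in> carrier L" "a [^] ?v = a"
      using a roots_mem_iff_is_root[OF f] root_iff by auto
    have Y: "?Y \<in> carrier ?P" by (rule linear_poly_closed[OF aS(1)])
    have C: "?C \<in> carrier ?P" by (rule ring_hom_closed[OF hom aS(1)])
    have "?C [^]\<^bsub>?P\<^esub> k = poly_of_const (a [^] k)" for k :: nat
      using aS(1) by (induction k) (simp_all add: ring_hom_one[OF hom] ring_hom_mult[OF hom])
    \<comment> \<open>The polynomial ring has characteristic \<open>p\<close> too, so raising to the
      power \<open>?v\<close> is additive there; it fixes the constant \<open>?C\<close> because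
      \<open>a\<close> is a root.\<close>
    then have "X [^]\<^bsub>?P\<^esub> ?v = ?Y [^]\<^bsub>?P\<^esub> ?v \<oplus>\<^bsub>?P\<^esub> ?C"
      unfolding var_eq_linear_plus_const[OF aS(1)] using P.frobenius_add[OF p(1) char Y C] aS(2) by simp
    then have "?f = ?Y [^]\<^bsub>?P\<^esub> ?v \<oplus>\<^bsub>?P\<^esub> ?C \<ominus>\<^bsub>?P\<^esub> (?Y \<oplus>\<^bsub>?P\<^esub> ?C)"
      using var_eq_linear_plus_const[OF aS(1)] by simp
    also have "\<dots> = ?Y [^]\<^bsub>?P\<^esub> ?v \<ominus>\<^bsub>?P\<^esub> ?Y"
      using Y C P.nat_pow_closed[OF Y, of ?v] by algebra
    finally have f_eq: "?Y = ?Y [^]\<^bsub>?P\<^esub> ?v \<ominus>\<^bsub>?P\<^esub> ?f"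
      using Y P.nat_pow_closed[OF Y, of ?v] by algebra
    \<comment> \<open>The square of \<open>?Y\<close> divides \<open>?f\<close> by the assumed
      multiplicity, and \<open>?Y ^ ?v\<close> because 2 \<le> \<open>?v\<close>. It then divides
      their difference \<open>?Y\<close>, against the degrees.\<close>
    have "(?Y [^]\<^bsub>?P\<^esub> (2::nat)) divides\<^bsub>?P\<^esub> ?f"
      using le_alg_mult_imp_pdivides[OF aS(1) f two] unfolding pdivides_def .
    moreover have "(?Y [^]\<^bsub>?P\<^esub> (2::nat)) divides\<^bsub>?P\<^esub> (?Y [^]\<^bsub>?P\<^esub> ?v)"
      using polynomial_pow_division[OF Y, of 2 ?v] v unfolding pdivides_def by simp
    ultimately obtain g h where gh: "g \<in> carrier ?P" "h \<in> carrier ?P"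
      "?f = ?Y [^]\<^bsub>?P\<^esub> (2::nat) \<otimes>\<^bsub>?P\<^esub> g" "?Y [^]\<^bsub>?P\<^esub> ?v = ?Y [^]\<^bsub>?P\<^esub> (2::nat) \<otimes>\<^bsub>?P\<^esub> h"
      by (auto elim!: dividesE)
    have "?Y = ?Y [^]\<^bsub>?P\<^esub> (2::nat) \<otimes>\<^bsub>?P\<^esub> (h \<ominus>\<^bsub>?P\<^esub> g)"
      using f_eq gh(1,2) P.nat_pow_closed[OF Y, of 2] unfolding gh(3,4) by algebra
    then have "(?Y [^]\<^bsub>?P\<^esub> (2::nat)) pdivides ?Y"
      using gh(1,2) unfolding pdivides_def by (intro dividesI[of "h \<ominus>\<^bsub>?P\<^esub> g"]) auto
    from pdivides_imp_degree_le[OF carrier_is_subring _ Y _ this]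
    show False using polynomial_pow_degree[OF Y, of 2] Y by simp
  qed
  \<comment> \<open>Over an algebraically closed field the roots counted with multiplicity are as
    many as the degree; simplicity makes this the number of distinct roots.\<close>
  have "?v = size (roots ?f)" using roots_over_carrier[OF f] deg unfolding splitted_def by simp
  also have "\<dots> = (\<Sum>a\<in>set_mset (roots ?f). 1)"
    unfolding size_multiset_overloaded_eq using simple by (intro sum.cong) auto
  also have "set_mset (roots ?f) = ?S"
    using roots_mem_iff_is_root[OF f] root_iff by blast
  finally show ?thesis by simp
qed

lemma (in field) subfield_frobenius_fixed:
  assumes p: "prime (p :: nat)" "[p] \<cdot> \<one> = \<zero>"
  shows "subfield {x \<in> carrier R. x [^] (p ^ n) = x} R" (is "subfield ?S R")
proof (rule subfieldI')
  let ?v = "p ^ n"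
  have v: "?v > 0" using p(1) prime_gt_0_nat by simp
  show "subring ?S R"
  proof (rule subringI)
    fix x assume x: "x \<in> ?S"
    \<comment> \<open>Evaluating the power of \<open>x - x\<close> treats even and odd
      characteristic alike, without computing the sign of \<open>(-1) ^ ?v\<close>.\<close>
    have "\<zero> = (x \<oplus> \<ominus> x) [^] ?v" using x v by (simp add: r_neg nat_pow_zero)
    also have "\<dots> = x \<oplus> (\<ominus> x) [^] ?v" using x by (simp add: frobenius_add[OF p])
    finally have "(\<ominus> x) [^] ?v = \<ominus> x" using x by (metis (no_types, lifting) a_inv_closed mem_Collect_eq
      minus_equality minus_minus nat_pow_closed)
    then show "\<ominus> x \<in> ?S" using x by simp
  qed (auto simp: frobenius_add[OF p] nat_pow_distrib)
  fix x assume x: "x \<in> ?S - {\<zero>}"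
  then have U: "x \<in> Units R" by (simp add: field_Units)
  have "x \<otimes> (inv x) [^] ?v = (x \<otimes> inv x) [^] ?v"
    using x nat_pow_distrib[OF _ Units_inv_closed[OF U], of x ?v] by simp
  also have "\<dots> = \<one>" using U by simp
  finally have "(inv x) [^] ?v = inv x" using x U by (metis (no_types, lifting) Diff_iff Units_inv_closed
      comm_inv_char mem_Collect_eq nat_pow_closed)
  then show "inv x \<in> ?S" using U by simp
qed

text \<open>The field consists of the solutions of \<open>x ^ v = x\<close> in an algebraic closure
  of the integers modulo \<open>p\<close>; the type is the one in which that closure is
  built.\<close>

theorem finite_field_exists:
  assumes "primepow (v :: nat)"
  shows "\<exists>F :: ((int list \<times> nat) multiset \<Rightarrow> int) ring. field F \<and> card (carrier F) = v"
proof -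
  obtain p n where p: "prime p" and n: "n > 0" and v: "v = p ^ n"
    using assms unfolding primepow_def by blast
  define K where "K = residue_ring (int p)"
  interpret K: residues_prime p K by unfold_locales (simp_all add: p K_def)
  interpret K: field K by (rule K.is_field)
  obtain L :: "((int list \<times> nat) multiset \<Rightarrow> int) ring"
    where L: "algebraic_closure L (K.indexed_const ` carrier K)" "K.indexed_const \<in> ring_hom K L"
    by (rule K.exists_closure)
  interpret L: algebraic_closure L "K.indexed_const ` carrier K" by (rule L(1))
  have "[k] \<cdot>\<^bsub>K\<^esub> \<one>\<^bsub>K\<^esub> = int k mod int p" for k :: nat
    by (induction k) (simp_all add: K.res_zero_eq K.res_one_eq K.res_add_eq K.add.nat_pow_Suc mod_simps add.commute)
  then have "[p] \<cdot>\<^bsub>K\<^esub> \<one>\<^bsub>K\<^esub> = \<zero>\<^bsub>K\<^esub>" by (simp add: K.res_zero_eq)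
  then have char: "[p] \<cdot>\<^bsub>L\<^esub> \<one>\<^bsub>L\<^esub> = \<zero>\<^bsub>L\<^esub>"
    using ring_hom_add_pow_one[OF K.ring_axioms L.ring_axioms L(2), of p]
      ring_hom_zero[OF L(2) K.ring_axioms L.ring_axioms] by simp
  let ?S = "{x \<in> carrier L. x [^]\<^bsub>L\<^esub> (p ^ n) = x}"
  have "field (L\<lparr>carrier := ?S\<rparr>)"
    using L.subfield_iff(2)[OF L.subfield_frobenius_fixed[OF p char]] .
  moreover have "card ?S = v" unfolding v by (rule L.card_frobenius_fixed[OF p char n])
  ultimately show ?thesis by (intro exI[of _ "L\<lparr>carrier := ?S\<rparr>"]) simp
qed

section \<open>Polynomial codes over places of degree one and two\<close>

text \<open>The map \<open>x ^ 2 - x\<close> sends both 0 and 1 to 0, so on a finite field it is not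
  surjective either. A missed value \<open>c\<close> yields the rootless quadratic
  \<open>X ^ 2 - X - c\<close> in every characteristic.\<close>

lemma (in field) irreducible_quadratic_exists:
  assumes "finite (carrier R)"
  obtains q where "q \<in> carrier (poly_ring R)" "degree q = 2"
    "\<And>x. x \<in> carrier R \<Longrightarrow> eval q x \<noteq> \<zero>"
proof -
  let ?f = "\<lambda>x. x \<otimes> x \<ominus> x"
  have "?f \<zero> = ?f \<one>" by (simp add: a_minus_def r_neg)
  then have "\<not> inj_on ?f (carrier R)" using inj_onD[of ?f "carrier R" \<zero> \<one>] by auto
  then have "?f ` carrier R \<noteq> carrier R" using eq_card_imp_inj_on[OF assms, of ?f] by fastforce
  moreover have "?f ` carrier R \<subseteq> carrier R" by auto
  ultimately have "?f ` carrier R \<subset> carrier R" by (rule psubsetI[rotated])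
  from psubset_imp_ex_mem[OF this] obtain c where "c \<in> carrier R - ?f ` carrier R" ..
  then have c: "c \<in> carrier R" "c \<notin> ?f ` carrier R" by simp_all
  let ?q = "[\<one>, \<ominus> \<one>, \<ominus> c]"
  show thesis
  proof (rule that)
    show "?q \<in> carrier (poly_ring R)" using c(1) by (simp flip: univ_poly_carrier add: polynomial_def)
    fix x assume x: "x \<in> carrier R"
    have "eval ?q x = x [^] (2::nat) \<oplus> \<ominus> x \<oplus> \<ominus> c"
      using x c(1) by (simp add: numeral_2_eq_2 l_minus a_assoc)
    also have "\<dots> = ?f x \<ominus> c" using x c(1) by (simp add: numeral_2_eq_2 a_minus_def a_assoc)
    finally show "eval ?q x \<noteq> \<zero>" using x c by (auto simp: r_right_minus_eq)
  qed simp
qed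

text \<open>Length is used instead of degree because the zero polynomial is the empty list, whose
  degree is 0: with length, \<open>u = 0\<close> leaves exactly the zero polynomial.\<close>

definition (in ring) polys_below :: "nat \<Rightarrow> 'a list set" where
  "polys_below u = {f \<in> carrier (poly_ring R). length f \<le> u}"

text \<open>Padding with leading zeros is inverse to normalisation, so these polynomials correspond
  to all coefficient lists of length \<open>u\<close>.\<close>

lemma (in field) card_polys_below:
  assumes "finite (carrier R)"
  shows "card (polys_below u) = card (carrier R) ^ u"
proof -
  have "bij_betw normalize {xs. set xs \<subseteq> carrier R \<and> length xs = u} (polys_below u)"
  proof (rule bij_betw_byWitness[where f' = "\<lambda>f. replicate (u - length f) \<zero> @ f"])
    show "\<forall>xs\<in>{xs. set xs \<subseteq> carrier R \<and> length xs = u}.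
        replicate (u - length (normalize xs)) \<zero> @ normalize xs = xs"
      using normalize_def' by (metis (mono_tags, lifting) mem_Collect_eq)
    show "\<forall>f\<in>polys_below u. normalize (replicate (u - length f) \<zero> @ f) = f"
      using normalize_polynomial[of "carrier R"]
      by (auto simp: polys_below_def normalize_replicate_zero simp flip: univ_poly_carrier)
    show "normalize ` {xs. set xs \<subseteq> carrier R \<and> length xs = u} \<subseteq> polys_below u"
      using normalize_gives_polynomial normalize_length_le
      by (auto simp: polys_below_def simp flip: univ_poly_carrier)
    show "(\<lambda>f. replicate (u - length f) \<zero> @ f) ` polys_below u \<subseteq> {xs. set xs \<subseteq> carrier R \<and> length xs = u}"
      using polynomial_incl by (fastforce simp: polys_below_def simp flip: univ_poly_carrier)
  qed
  then show ?thesis using card_lists_length_eq[OF assms, of u] bij_betw_same_card by fastforce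
qed

lemma (in field) poly_eqI:
  assumes "f \<in> carrier (poly_ring R)" "g \<in> carrier (poly_ring R)" "length f \<le> d" "length g \<le> d"
    and eq: "\<And>i. i < d \<Longrightarrow> coeff f i = coeff g i"
  shows "f = g"
proof -
  have "coeff f = coeff g"
  proof
    fix i show "coeff f i = coeff g i"
      using eq[of i] coeff_length[of f i] coeff_length[of g i] assms(3,4) by (cases "i < d") auto
  qed
  then show ?thesis
    using coeff_iff_polynomial_cond[of "carrier R" f g] assms(1,2) by (simp add: univ_poly_carrier)
qed

section \<open>Expansion of a polynomial in base \<open>q\<close>\<close>

definition (in ring) digit :: "'a list \<Rightarrow> nat \<Rightarrow> 'a list \<Rightarrow> 'a list" where
  "digit q k f = ((\<lambda>f. f pdiv q) ^^ k) f pmod q"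

lemma (in ring) digit_0: "digit q 0 f = f pmod q"
  and digit_Suc: "digit q (Suc k) f = digit q k (f pdiv q)"
  unfolding digit_def by (simp_all add: funpow_Suc_right del: funpow.simps(2))

lemma (in field) digit_closed:
  assumes "q \<in> carrier (poly_ring R)" "f \<in> carrier (poly_ring R)"
  shows "digit q k f \<in> carrier (poly_ring R)"
  using assms(2)
  by (induction k arbitrary: f) (auto simp: digit_0 digit_Suc long_division_closed[OF carrier_is_subfield _ assms(1)])

lemma (in field) length_digit_le:
  assumes "q \<in> carrier (poly_ring R)" "f \<in> carrier (poly_ring R)" "degree q > 0"
  shows "length (digit q k f) \<le> degree q"
  using assms(2)
proof (induction k arbitrary: f)
  case 0
  then show ?case
    using pmod_degree[OF carrier_is_subfield 0 assms(1)] assms(3) by (cases "q = []") (auto simp: digit_0)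
qed (simp add: digit_Suc long_division_closed[OF carrier_is_subfield _ assms(1)])

text \<open>Equal lowest digits cancel, so the difference is \<open>q\<close> times the difference
  of the quotients, to which induction applies.\<close>

lemma (in field) digits_eq_imp_pow_pdivides:
  assumes q: "q \<in> carrier (poly_ring R)"
    and "f \<in> carrier (poly_ring R)" "g \<in> carrier (poly_ring R)"
    and "\<And>i. i < k \<Longrightarrow> digit q i f = digit q i g"
  shows "(q [^]\<^bsub>poly_ring R\<^esub> k) pdivides (f \<ominus>\<^bsub>poly_ring R\<^esub> g)"
  using assms(2-)
proof (induction k arbitrary: f g)
  case 0
  interpret P: domain "poly_ring R" by (rule univ_poly_is_domain[OF carrier_is_subring])
  show ?case unfolding pdivides_def by (rule dividesI[of "f \<ominus>\<^bsub>poly_ring R\<^esub> g"]) (use 0 in auto)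
next
  case (Suc k)
  let ?P = "poly_ring R"
  interpret P: domain ?P by (rule univ_poly_is_domain[OF carrier_is_subring])
  note closed = long_division_closed[OF carrier_is_subfield _ q]
  let ?r = "f pmod q"
  have r: "g pmod q = ?r" using Suc.prems(3)[of 0] by (simp add: digit_0)
  have "digit q i (f pdiv q) = digit q i (g pdiv q)" if "i < k" for i
    using Suc.prems(3)[of "Suc i"] that by (simp add: digit_Suc)
  with closed(1)[OF Suc.prems(1)] closed(1)[OF Suc.prems(2)]
  have "(q [^]\<^bsub>?P\<^esub> k) pdivides ((f pdiv q) \<ominus>\<^bsub>?P\<^esub> (g pdiv q))" by (rule Suc.IH)
  then obtain h where h: "h \<in> carrier ?P" "(f pdiv q) \<ominus>\<^bsub>?P\<^esub> (g pdiv q) = q [^]\<^bsub>?P\<^esub> k \<otimes>\<^bsub>?P\<^esub> h"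
    unfolding pdivides_def by (auto elim: dividesE)
  have "f \<ominus>\<^bsub>?P\<^esub> g = (q \<otimes>\<^bsub>?P\<^esub> (f pdiv q) \<oplus>\<^bsub>?P\<^esub> ?r) \<ominus>\<^bsub>?P\<^esub> (q \<otimes>\<^bsub>?P\<^esub> (g pdiv q) \<oplus>\<^bsub>?P\<^esub> ?r)"
    using pdiv_pmod[OF carrier_is_subfield Suc.prems(1) q] pdiv_pmod[OF carrier_is_subfield Suc.prems(2) q] r
    by simp
  also have "\<dots> = q \<otimes>\<^bsub>?P\<^esub> ((f pdiv q) \<ominus>\<^bsub>?P\<^esub> (g pdiv q))"
    using closed[OF Suc.prems(1)] closed[OF Suc.prems(2)] q by algebra
  also have "\<dots> = q [^]\<^bsub>?P\<^esub> Suc k \<otimes>\<^bsub>?P\<^esub> h"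
    unfolding h(2) using h(1) q by (simp add: P.m_ac)
  finally show ?case using h(1) unfolding pdivides_def by (intro dividesI)
qed

lemma (in field) length_pdiv_le:
  assumes "f \<in> carrier (poly_ring R)" "q \<in> carrier (poly_ring R)" "degree q > 0"
  shows "length (f pdiv q) \<le> length f - degree q"
proof (cases "f pdiv q = []")
  case False
  note closed = long_division_closed[OF carrier_is_subfield assms(1,2)]
  interpret P: domain "poly_ring R" by (rule univ_poly_is_domain[OF carrier_is_subring])
  have "q \<noteq> []" using assms(3) by auto
  have deg: "degree (q \<otimes>\<^bsub>poly_ring R\<^esub> (f pdiv q)) = degree q + degree (f pdiv q)"
    using poly_mult_degree_eq[OF carrier_is_subring] closed(1) assms(2) False \<open>q \<noteq> []\<close>
    by (simp add: univ_poly_mult univ_poly_carrier)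
  have less: "degree (f pmod q) < degree q"
    using pmod_degree[OF carrier_is_subfield assms(1,2) \<open>q \<noteq> []\<close>] assms(3) by auto
  have "degree f = degree ((q \<otimes>\<^bsub>poly_ring R\<^esub> (f pdiv q)) \<oplus>\<^bsub>poly_ring R\<^esub> (f pmod q))"
    using pdiv_pmod[OF carrier_is_subfield assms(1,2)] by simp
  also have "\<dots> = degree q + degree (f pdiv q)"
    unfolding univ_poly_add using closed assms(2) deg less P.m_closed[OF assms(2) closed(1)]
    by (subst poly_add_degree_eq[OF carrier_is_subring]) (auto simp: univ_poly_carrier)
  finally show ?thesis using assms(3) False by (cases "f pdiv q") auto
qed simp

text \<open>Each division by \<open>q\<close> removes two coefficients, so what is left after
  \<open>k\<close> divisions is constant. This settles the half-recorded top digit when all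
  \<open>u\<close> entries lie at \<open>q\<close> and \<open>u\<close> is odd.\<close>

lemma (in field) length_digit_le_one:
  assumes "q \<in> carrier (poly_ring R)" "degree q = 2"
    and "f \<in> carrier (poly_ring R)" "length f \<le> 2 * k + 1"
  shows "length (digit q k f) \<le> 1"
  using assms(3,4)
proof (induction k arbitrary: f)
  case 0
  then have "f pmod q = f" using assms(1,2) by (intro pmod_const(2)[OF carrier_is_subfield]) auto
  with 0 show ?case by (simp add: digit_0)
next
  case (Suc k)
  have "length (f pdiv q) \<le> length f - 2"
    using length_pdiv_le[OF Suc.prems(1) assms(1), unfolded assms(2)] by simp
  then show ?case
    using Suc long_division_closed(1)[OF carrier_is_subfield Suc.prems(1) assms(1)]
    by (simp add: digit_Suc)
qed

text \<open>The column blocks are indexed by the places of the rational function field: \<open>i < v\<close> is the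
  rational place \<open>X = pt i\<close>, \<open>i = v\<close> the infinite one (for polynomials of degree less than \<open>u\<close>),
  and \<open>i = v + 1\<close> a place \<open>q\<close> of degree 2, each of whose digits fills two columns.\<close>

definition (in ring) place_entry :: "(nat \<Rightarrow> 'a) \<Rightarrow> 'a list \<Rightarrow> nat \<Rightarrow> nat \<Rightarrow> nat \<Rightarrow> nat \<Rightarrow> 'a list \<Rightarrow> 'a" where
  "place_entry pt q v u i k f =
     (if i < v then coeff (digit [\<one>, \<ominus> pt i] k f) 0
      else if i = v then coeff f (u - 1 - k)
      else coeff (digit q (k div 2) f) (k mod 2))"

text \<open>Each exponent is at most the multiplicity of its root, the roots are distinct, and the
  multiplicities sum to at most the degree.\<close>

lemma (in field) sum_alg_mult_le_degree:
  assumes f: "f \<in> carrier (poly_ring R)" "f \<noteq> []" and pt: "inj_on pt A" "pt ` A \<subseteq> carrier R" "finite A"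
    and dvd: "\<And>i. i \<in> A \<Longrightarrow> ([\<one>, \<ominus> pt i] [^]\<^bsub>poly_ring R\<^esub> (h i :: nat)) pdivides f"
  shows "sum h A \<le> degree f"
proof -
  have "sum h A \<le> (\<Sum>i\<in>A. count (roots f) (pt i))"
    using alg_multE(2)[OF _ f dvd] pt(2) by (intro sum_mono) (auto simp flip: alg_mult_eq_count_roots[OF f(1)])
  also have "\<dots> = (\<Sum>a\<in>pt ` A. count (roots f) a)" by (simp add: sum.reindex[OF pt(1)])
  also have "\<dots> = (\<Sum>a\<in>pt ` A \<inter> set_mset (roots f). count (roots f) a)"
    using pt(3) by (intro sum.mono_neutral_right) (auto simp: not_in_iff)
  also have "\<dots> \<le> size (roots f)"
    unfolding size_multiset_overloaded_eq by (intro sum_mono2) auto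
  also have "\<dots> \<le> degree f" by (rule size_roots_le_degree[OF f(1)])
  finally show ?thesis .
qed

text \<open>Agreement at infinity pushes the degree of a nonzero difference below
  \<open>u - h v\<close>, while agreement at the other places forces divisors of total degree at
  least \<open>u - h v\<close>.\<close>

lemma (in field) place_entry_inj:
  assumes pt: "inj_on pt {..<v}" "pt ` {..<v} \<subseteq> carrier R"
    and q: "q \<in> carrier (poly_ring R)" "degree q = 2" "\<And>x. x \<in> carrier R \<Longrightarrow> eval q x \<noteq> \<zero>"
    and h: "sum h {..v + 1} = u" "even (h (v + 1)) \<or> h (v + 1) = u"
    and fg: "f \<in> polys_below u" "g \<in> polys_below u"
    and eq: "\<And>i k. i \<le> v + 1 \<Longrightarrow> k < h i \<Longrightarrow>
      place_entry pt q v u i k f = place_entry pt q v u i k g"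
  shows "f = g"
proof (rule ccontr)
  assume "f \<noteq> g"
  let ?P = "poly_ring R"
  interpret P: domain ?P by (rule univ_poly_is_domain[OF carrier_is_subring])
  have f: "f \<in> carrier ?P" "length f \<le> u" and g: "g \<in> carrier ?P" "length g \<le> u"
    using fg unfolding polys_below_def by auto
  let ?D = "f \<ominus>\<^bsub>?P\<^esub> g"
  have D: "?D \<in> carrier ?P" using f(1) g(1) by simp
  have D0: "?D \<noteq> []"
    using \<open>f \<noteq> g\<close> P.r_right_minus_eq[OF f(1) g(1)] by (simp add: univ_poly_zero)
  have sets: "set g \<subseteq> carrier R" "set ?D \<subseteq> carrier R"
    using g(1) D polynomial_in_carrier[OF carrier_is_subring] by (auto simp only: univ_poly_carrier)
  have "f = g \<oplus>\<^bsub>?P\<^esub> ?D" using f(1) g(1) by algebra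
  then have "f = poly_add g ?D" by (simp only: univ_poly_add)
  then have coeff_f: "coeff f = (\<lambda>i. coeff g i \<oplus> coeff ?D i)"
    using poly_add_coeff[OF sets] by (rule trans[OF arg_cong[of _ _ coeff]])
  have coeff_D: "coeff ?D i = \<zero>" if "coeff f i = coeff g i" for i
  proof -
    have "coeff g i \<oplus> coeff ?D i = coeff g i"
      using fun_cong[OF coeff_f, of i] unfolding that by (rule sym)
    then show ?thesis
      by (simp only: add.l_cancel_one[OF coeff_in_carrier[OF sets(1)] coeff_in_carrier[OF sets(2)]])
  qed
  \<comment> \<open>The entries at infinity are the \<open>h v\<close> highest of the
    \<open>u\<close> coefficients; where they agree, the difference cannot have its leading
    coefficient.\<close>
  have deg_D: "degree ?D < u - h v"
  proof (rule ccontr)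
    let ?d = "degree ?D"
    assume d: "\<not> ?d < u - h v"
    have "coeff f ?d = coeff g ?d"
    proof (cases "?d < u")
      case True
      then have "u - 1 - ?d < h v" "u - 1 - (u - 1 - ?d) = ?d" using d by auto
      then show ?thesis using eq[of v "u - 1 - ?d"] by (simp add: place_entry_def)
    next
      case False
      then show ?thesis using f(2) g(2) by (simp add: coeff_length)
    qed
    then have "lead_coeff ?D = \<zero>" using coeff_D lead_coeff_simp[OF D0] by simp
    then show False using D D0 by (simp flip: univ_poly_carrier add: polynomial_def)
  qed
  have lin: "[\<one>, \<ominus> pt i] \<in> carrier ?P" if "i < v" for i
    using pt(2) that by (intro linear_poly_closed) auto
  have lin_dvd: "([\<one>, \<ominus> pt i] [^]\<^bsub>?P\<^esub> h i) pdivides ?D" if i: "i < v" for i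
  proof (rule digits_eq_imp_pow_pdivides[OF lin[OF i] f(1) g(1)])
    fix k assume k: "k < h i"
    let ?l = "[\<one>, \<ominus> pt i]"
    \<comment> \<open>Digits in a linear base are constants, namely the Taylor coefficients at
      \<open>pt i\<close>, so the recorded coefficient is the whole digit.\<close>
    show "digit ?l k f = digit ?l k g"
    proof (rule poly_eqI[where d = 1])
      fix j :: nat assume "j < 1"
      then show "coeff (digit ?l k f) j = coeff (digit ?l k g) j"
        using eq[of i k] i k by (simp add: place_entry_def)
    qed (use digit_closed[OF lin[OF i]] length_digit_le[OF lin[OF i]] f(1) g(1) in auto)
  qed
  \<comment> \<open>Rounded up, so that a last digit with only one recorded coefficient counts in
    full.\<close>
  define m where "m = (h (v + 1) + 1) div 2"
  have q_dvd: "(q [^]\<^bsub>?P\<^esub> m) pdivides ?D"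
  proof (rule digits_eq_imp_pow_pdivides[OF q(1) f(1) g(1)])
    fix k assume k: "k < m"
    show "digit q k f = digit q k g"
    proof (rule poly_eqI[where d = 2])
      fix j :: nat assume j: "j < 2"
      show "coeff (digit q k f) j = coeff (digit q k g) j"
      proof (cases "2 * k + j < h (v + 1)")
        case True
        have "(2 * k + j) div 2 = k" "(2 * k + j) mod 2 = j" using j by auto
        then show ?thesis using eq[OF le_refl True] unfolding place_entry_def by simp
      next
        case False
        \<comment> \<open>The only coefficient that may be unrecorded is the linear one of the last
          digit. Then \<open>h (v + 1)\<close> is odd, hence equal to \<open>u\<close>, and this
          digit is constant for both polynomials.\<close>
        have "2 * k + 1 \<le> h (v + 1)" using k unfolding m_def by linarith
        with False j have j1: "j = 1" and "h (v + 1) = 2 * k + 1" by linarith+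
        then have "u = 2 * k + 1" using h(2) by auto
        then show ?thesis
          using length_digit_le_one[OF q(1,2) f(1), of k] length_digit_le_one[OF q(1,2) g(1), of k]
            f(2) g(2) j1 coeff_length[of "digit q k f" 1] coeff_length[of "digit q k g" 1] by simp
      qed
    qed (use digit_closed[OF q(1)] length_digit_le[OF q(1)] q(2) f(1) g(1) in auto)
  qed
  have qm: "q [^]\<^bsub>?P\<^esub> m \<in> carrier ?P" using q(1) by simp
  obtain H where H: "H \<in> carrier ?P" "?D = q [^]\<^bsub>?P\<^esub> m \<otimes>\<^bsub>?P\<^esub> H"
    using q_dvd unfolding pdivides_def by (auto elim: dividesE)
  have H0: "H \<noteq> []" using D0 H(2) P.r_null[OF qm] by (auto simp: univ_poly_zero)
  have q0: "q [^]\<^bsub>?P\<^esub> m \<noteq> []" using q(1,2) by (intro polynomial_pow_not_zero) auto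
  have "degree ?D = degree (q [^]\<^bsub>?P\<^esub> m) + degree H"
    unfolding H(2) using poly_mult_degree_eq[OF carrier_is_subring] qm H(1) H0 q0
    by (simp add: univ_poly_mult univ_poly_carrier)
  then have deg: "degree ?D = 2 * m + degree H" using polynomial_pow_degree[OF q(1), of m] q(2) by simp
  \<comment> \<open>Since \<open>q\<close> has no roots, the irreducible \<open>X - pt i\<close>
    does not divide the power of \<open>q\<close>, so its power must divide the cofactor
    \<open>H\<close>.\<close>
  have "([\<one>, \<ominus> pt i] [^]\<^bsub>?P\<^esub> h i) pdivides H" if i: "i \<in> {..<v}" for i
  proof -
    have a: "pt i \<in> carrier R" and i: "i < v" using i pt(2) by auto
    interpret ev: ring_hom_cring ?P R "\<lambda>p. eval p (pt i)"
      by (rule eval_cring_hom[OF carrier_is_subring a])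
    have "eval (q [^]\<^bsub>?P\<^esub> m) (pt i) = eval q (pt i) [^] m" using q(1) by simp
    moreover have "eval q (pt i) [^] k \<noteq> \<zero>" for k :: nat
      using q(3)[OF a] ev.hom_closed[OF q(1)] by (induction k) (auto simp: integral_iff)
    ultimately have "eval (q [^]\<^bsub>?P\<^esub> m) (pt i) \<noteq> \<zero>" by simp
    moreover have "eval [\<one>, \<ominus> pt i] (pt i) = \<zero>" using a by (simp add: r_neg)
    ultimately have "\<not> [\<one>, \<ominus> pt i] pdivides (q [^]\<^bsub>?P\<^esub> m)"
      using pdivides_imp_root_sharing[OF lin[OF i] _ a] by blast
    then show ?thesis
      using pirreducible_pow_pdivides_iff[OF carrier_is_subfield lin[OF i] qm H(1)
          degree_one_imp_pirreducible[OF carrier_is_subfield lin[OF i]]] lin_dvd[OF i] H(2) by simp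
  qed
  then have "sum h {..<v} \<le> degree H"
    using sum_alg_mult_le_degree[OF H(1) H0 pt] by simp
  moreover have "sum h {..v + 1} = sum h {..<v} + h v + h (v + 1)"
    by (simp flip: lessThan_Suc_atMost)
  moreover have "h (v + 1) \<le> 2 * m" unfolding m_def by simp
  ultimately show False using deg deg_D h(1) by linarith
qed

section \<open>The upper bound\<close>

text \<open>The bijection \<open>\<sigma>\<close> renames field elements as numbers below
  \<open>v\<close>, and its inverse enumerates the finite rational places. Blocks 0 to
  \<open>v + 1\<close> give the \<open>v + 2\<close> blocks required.\<close>

lemma nrt_code_exists:
  assumes "primepow v"
  shows "\<exists>(P :: nat \<Rightarrow> ((int list \<times> nat) multiset \<Rightarrow> int) list set) E. nrt_code v (v + 1) P E"
proof -
  obtain F :: "((int list \<times> nat) multiset \<Rightarrow> int) ring" where "field F" and card: "card (carrier F) = v"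
    using finite_field_exists[OF assms] by blast
  interpret F: field F by fact
  have v: "0 < v" using primepow_gt_Suc_0[OF assms] by simp
  then have fin: "finite (carrier F)" using card card_ge_0_finite by blast
  obtain \<sigma> where \<sigma>: "bij_betw \<sigma> (carrier F) {0..<v}" using ex_bij_betw_finite_nat[OF fin] card by blast
  define pt where "pt = inv_into (carrier F) \<sigma>"
  have pt: "bij_betw pt {..<v} (carrier F)"
    using bij_betw_inv_into[OF \<sigma>] unfolding pt_def atLeast0LessThan .
  obtain q where q: "q \<in> carrier (poly_ring F)" "degree q = 2"
    "\<And>x. x \<in> carrier F \<Longrightarrow> F.eval q x \<noteq> \<zero>\<^bsub>F\<^esub>"
    by (rule F.irreducible_quadratic_exists[OF fin], rule that)
  let ?e = "F.place_entry pt q v"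
  have coeff: "F.coeff f i \<in> carrier F" if "f \<in> carrier (poly_ring F)" for f i
    using F.poly_coeff_in_carrier[OF F.carrier_is_subring] that by (simp add: univ_poly_carrier)
  have closed: "?e u i k f \<in> carrier F" if "f \<in> F.polys_below u" for u i k f
  proof -
    have f: "f \<in> carrier (poly_ring F)" using that unfolding F.polys_below_def by simp
    have "[\<one>\<^bsub>F\<^esub>, \<ominus>\<^bsub>F\<^esub> pt i] \<in> carrier (poly_ring F)" if "i < v"
      using bij_betwE[OF pt] that by (intro F.linear_poly_closed) simp
    then show ?thesis
      unfolding F.place_entry_def using coeff F.digit_closed[OF _ f] q(1) f by simp
  qed
  have "nrt_code v (v + 1) F.polys_below (\<lambda>u i k f. \<sigma> (?e u i k f))"
  proof
    show "0 < v" by fact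
    show "card (F.polys_below u) = v ^ u" for u using F.card_polys_below[OF fin, of u] card by simp
    show "\<sigma> (?e u i k f) < v" if "f \<in> F.polys_below u" for u i k f
      using bij_betwE[OF \<sigma>] closed[OF that] by fastforce
    fix u :: nat and h f g
    assume h: "sum h {..v + 1} = u" "even (h (v + 1)) \<or> h (v + 1) = u"
      and fg: "f \<in> F.polys_below u" "g \<in> F.polys_below u"
      and eq: "\<And>i k. i \<le> v + 1 \<Longrightarrow> k < h i \<Longrightarrow> \<sigma> (?e u i k f) = \<sigma> (?e u i k g)"
    show "f = g"
    proof (rule F.place_entry_inj[OF _ _ q h fg])
      show "inj_on pt {..<v}" "pt ` {..<v} \<subseteq> carrier F"
        using bij_betw_imp_inj_on[OF pt] bij_betw_imp_surj_on[OF pt] by simp_all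
      show "?e u i k f = ?e u i k g" if "i \<le> v + 1" "k < h i" for i k
        using inj_onD[OF bij_betw_imp_inj_on[OF \<sigma>] eq[OF that] closed[OF fg(1)] closed[OF fg(2)]] .
    qed
  qed
  then show ?thesis by blast
qed

section \<open>Comparison with the claimed bounds\<close>

lemma card_odd_less: "card {j. odd j \<and> j < t} \<le> t div 2"
proof -
  have "inj_on (\<lambda>j. j div 2) {j. odd j \<and> j < t}"
    by (rule inj_onI) (metis (mono_tags, lifting) mem_Collect_eq odd_two_times_div_two_succ)
  moreover have "(\<lambda>j. j div 2) ` {j. odd j \<and> j < t} \<subseteq> {..<t div 2}"
  proof (rule image_subsetI)
    fix j assume "j \<in> {j. odd j \<and> j < t}"
    then show "j div 2 \<in> {..<t div 2}" by (auto elim!: oddE)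
  qed
  ultimately show ?thesis using card_inj_on_le[of _ _ "{..<t div 2}"] by fastforce
qed

text \<open>The left side is twice the sum of \<open>1 / x ^ i\<close> over 1 \<le> \<open>i\<close>
  \<le> \<open>k\<close>, written in closed form. Its denominator \<open>x - 1\<close> is at least 1
  and may be dropped.\<close>

lemma geometric_term_le:
  fixes x :: real
  assumes "2 \<le> x"
  shows "2 / (1 - x) * (1 / x ^ k - 1) \<le> 2 - 2 / x ^ k"
proof -
  have pos: "0 \<le> 1 - 1 / x ^ k" using assms by (simp add: one_le_power)
  have "2 / (1 - x) * (1 / x ^ k - 1) = 2 * ((1 - 1 / x ^ k) / (x - 1))"
    using assms by (simp add: field_simps)
  also have "\<dots> \<le> 2 * ((1 - 1 / x ^ k) / 1)"
    using assms pos by (intro mult_left_mono divide_left_mono) auto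
  finally show ?thesis by simp
qed

theorem corollary9:
  fixes v t :: nat
  assumes "primepow v" and "2 \<le> t"
  shows "(odd t \<longrightarrow>
           real (OCAN t (v + 2) t v) \<le>
             real v ^ t * (real t - 2 / (1 - real v) * (1 / real v ^ ((t - 1) div 2) - 1))) \<and>
         (even t \<longrightarrow>
           real (OCAN t (v + 2) t v) \<le>
             real v ^ t * (real t - 2 / (1 - real v) * (1 / real v ^ ((t - 2) div 2) - 1)
                           - 1 / real v ^ (t div 2)))"
proof -
  define x where "x = real v"
  have v: "2 \<le> v" using primepow_gt_Suc_0[OF assms(1)] by simp
  then have x: "2 \<le> x" unfolding x_def by simp
  let ?Q = "{j. odd j \<and> j < t}"
  obtain P :: "nat \<Rightarrow> ((int list \<times> nat) multiset \<Rightarrow> int) list set" and E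
    where "nrt_code v (v + 1) P E" using nrt_code_exists[OF assms(1)] by blast
  then interpret nrt_code v "v + 1" P E .
  have "real (OCAN t (v + 2) t v) \<le> real (v ^ t + (\<Sum>j\<in>?Q. (v ^ (t - j) - 1) * v ^ j))"
    using OCAN_le[OF assms(2)] by (simp only: of_nat_le_iff add.assoc nat_1_add_1)
  also have "\<dots> = x ^ t + (\<Sum>j\<in>?Q. real ((v ^ (t - j) - 1) * v ^ j))"
    unfolding x_def by simp
  also have "(\<Sum>j\<in>?Q. real ((v ^ (t - j) - 1) * v ^ j)) = (\<Sum>j\<in>?Q. x ^ t - x ^ j)"
  proof (rule sum.cong)
    fix j assume j: "j \<in> ?Q"
    have "1 \<le> v ^ (t - j)" using v by simp
    then have "real ((v ^ (t - j) - 1) * v ^ j) = (x ^ (t - j) - 1) * x ^ j"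
      unfolding x_def by (simp add: of_nat_diff)
    also have "\<dots> = x ^ t - x ^ j" using j by (simp add: left_diff_distrib flip: power_add)
    finally show "real ((v ^ (t - j) - 1) * v ^ j) = x ^ t - x ^ j" .
  qed simp
  finally have le: "real (OCAN t (v + 2) t v) \<le> x ^ t + (\<Sum>j\<in>?Q. x ^ t - x ^ j)" .
  consider "t = 2" | "t = 3" | "t = 4" | "5 \<le> t" using assms(2) by linarith
  then show ?thesis
  proof cases
    case 1
    have "?Q = {1}" using 1 by (auto elim!: oddE)
    then have "real (OCAN t (v + 2) t v) \<le> x\<^sup>2 + (x\<^sup>2 - x)" using le 1 by simp
    also have "\<dots> = x\<^sup>2 * (2 - 1 / x)" using x by (simp add: field_simps power2_eq_square)
    finally show ?thesis using 1 unfolding x_def by simp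
  next
    case 2
    have "?Q = {1}" using 2 by (auto elim!: oddE)
    then have "real (OCAN t (v + 2) t v) \<le> x ^ 3 + (x ^ 3 - x)" using le 2 by simp
    also have "\<dots> \<le> 3 * x ^ 3 - 2 * x\<^sup>2"
    proof -
      have "2 * x\<^sup>2 \<le> x * x\<^sup>2" using x by (intro mult_right_mono) auto
      moreover have "x * x\<^sup>2 = x ^ 3" by (simp add: power3_eq_cube power2_eq_square)
      ultimately show ?thesis using x by linarith
    qed
    also have "\<dots> = x ^ 3 * (3 - 2 / (1 - x) * (1 / x - 1))"
      using x by (simp add: field_simps power3_eq_cube power2_eq_square)
    finally show ?thesis using 2 unfolding x_def by simp
  next
    case 3
    have "?Q = {1, 3}"
    proof
      show "?Q \<subseteq> {1, 3}" using 3 by (auto elim!: oddE)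
    qed (use 3 in auto)
    then have "real (OCAN t (v + 2) t v) \<le> x ^ 4 + ((x ^ 4 - x) + (x ^ 4 - x ^ 3))" using le 3 by simp
    also have "\<dots> \<le> 4 * x ^ 4 - 2 * x ^ 3 - x\<^sup>2"
    proof -
      \<comment> \<open>The slack is \<open>x ^ 4 - x ^ 3 - x ^ 2 + x\<close>, factored
        here.\<close>
      have "0 \<le> x * ((x - 1)\<^sup>2 * (x + 1))" using x by simp
      then show ?thesis by (simp add: algebra_simps power2_eq_square power3_eq_cube power4_eq_xxxx)
    qed
    also have "\<dots> = x ^ 4 * (4 - 2 / (1 - x) * (1 / x - 1) - 1 / x\<^sup>2)"
      using x by (simp add: field_simps power2_eq_square power3_eq_cube power4_eq_xxxx)
    finally show ?thesis using 3 unfolding x_def by simp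
  next
    case 4
    \<comment> \<open>From \<open>t = 5\<close> on a crude estimate suffices: without the terms
      \<open>x ^ j\<close> there remain at most \<open>1 + t div 2\<close> \<le>
      \<open>t - 2\<close> copies of \<open>x ^ t\<close>, and the claimed bounds subtract at most 2
      from \<open>t\<close>.\<close>
    have "(\<Sum>j\<in>?Q. x ^ t - x ^ j) \<le> (\<Sum>j\<in>?Q. x ^ t)" using x by (intro sum_mono) simp
    also have "\<dots> \<le> real (t div 2) * x ^ t"
      using card_odd_less[of t] x by (simp add: mult_right_mono)
    finally have "real (OCAN t (v + 2) t v) \<le> (1 + real (t div 2)) * x ^ t"
      using le by (simp add: algebra_simps)
    also have "\<dots> \<le> (real t - 2) * x ^ t"
    proof (rule mult_right_mono)
      have "t div 2 + 3 \<le> t" using 4 by linarith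
      then show "1 + real (t div 2) \<le> real t - 2" by linarith
    qed (use x in simp)
    finally have le': "real (OCAN t (v + 2) t v) \<le> x ^ t * (real t - 2)" by (simp add: mult.commute)
    have bound: "real (OCAN t (v + 2) t v) \<le> x ^ t * (real t - z)" if "z \<le> 2" for z
    proof -
      have "x ^ t * (real t - 2) \<le> x ^ t * (real t - z)" using x that by (intro mult_left_mono) auto
      with le' show ?thesis by linarith
    qed
    have "2 / (1 - x) * (1 / x ^ k - 1) \<le> 2" for k
      using geometric_term_le[OF x, of k] x by (smt (verit) divide_nonneg_nonneg zero_le_power)
    moreover have "2 / (1 - x) * (1 / x ^ ((t - 2) div 2) - 1) + 1 / x ^ (t div 2) \<le> 2"
    proof -
      let ?k = "(t - 2) div 2"
      have k: "t div 2 = Suc ?k" using 4 by linarith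
      \<comment> \<open>The extra term of the even case is absorbed by the \<open>2 / x ^ ?k\<close>
        that \<open>geometric_term_le\<close> leaves.\<close>
      have "1 / x ^ Suc ?k \<le> 1 / x ^ ?k" using x by (intro divide_left_mono power_increasing) auto
      moreover have "0 \<le> 1 / x ^ ?k" using x by simp
      ultimately show ?thesis unfolding k using geometric_term_le[OF x, of ?k] by linarith
    qed
    ultimately show ?thesis
      using bound[of "2 / (1 - x) * (1 / x ^ ((t - 1) div 2) - 1)"]
        bound[of "2 / (1 - x) * (1 / x ^ ((t - 2) div 2) - 1) + 1 / x ^ (t div 2)"]
      unfolding x_def by (simp add: diff_diff_eq)
  qed
qed

end
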